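(* Let $Q$ be a proper polyhedral cone in $\mathbb{R}^n$ that is permutation invariant. Then either (a) $Q$ is irreducible, in which case $\beta(Q)=1$; or (b) $Q$ is reducible, in which case $Q$ is isomorphic to $\mathbb{R}^n_+$ and $\beta(Q)=n$.
   Context: $\mathbb{R}^n$ carries its usual inner product $\langle\cdot,\cdot\rangle$, and $\mathbb{R}^n_+$ is the nonnegative orthant. $\Sigma_n$ is the set of all $n\times n$ permutation matrices. A nonempty set $K$ in a finite dimensional real Hilbert space is a convex cone if $tx+sy\in K$ for all $x,y\in K$ and $t,s\ge 0$ (so $0\in K$). It is pointed if $K\cap(-K)=\{0\}$, solid if it has nonempty interior, and proper if it is closed, pointed and solid. A closed convex cone is polyhedral if it is finitely generated, i.e. it is the set of all finite nonnegative linear combinations of elements of some finite set. Two convex cones are isomorphic if one can be mapped onto the other by an invertible linear transformation. A convex cone $Q$ in $\mathbb{R}^n$ is permutation invariant if $\sigma(Q)=Q$ for all $\sigma\in\Sigma_n$. A convex cone $K$ in a space $V$ is reducible if there exist nonempty nonzero sets $K_1,K_2\subseteq V$ (that is, neither is empty and neither equals $\{0\}$) with $K=K_1+K_2$ and $\operatorname{span}(K_1)\cap\operatorname{span}(K_2)=\{0\}$. A nonzero convex cone that is not reducible is irreducible. Lyapunov rank: for a proper cone $K$ in a finite dimensional real Hilbert space $V$, let $K^*=\{y\in V:\langle y,x\rangle\ge 0\ \ \forall x\in K\}$. A linear transformation $L:V\to V$ is Lyapunov-like on $K$ if for all $x\in K$ and $s\in K^*$ with $\langle x,s\rangle=0$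 one has $\langle L(x),s\rangle=0$. The set $\mathrm{LL}(K)$ of all such $L$ is a real vector space, and the Lyapunov rank of $K$ is $\beta(K):=\dim \mathrm{LL}(K)$. *)

theory Defs
  imports "HOL-Analysis.Analysis" "HOL-Library.Set_Algebras"
begin

text \<open>
  A finite dimensional real Hilbert space is rendered by the class \<open>euclidean_space\<close>, and
  R^n by \<open>real ^ 'n\<close> with \<open>n = CARD('n)\<close>.
  Convex cones are those of the library (\<open>convex_cone\<close>; see \<open>convex_cone_iff\<close>): they are
  nonempty and contain 0.
\<close>

definition pointed_cone :: "'a::euclidean_space set \<Rightarrow> bool" where
  "pointed_cone K \<longleftrightarrow> convex_cone K \<and> K \<inter> uminus ` K = {0}"

definition solid_cone :: "'a::euclidean_space set \<Rightarrow> bool" where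
  "solid_cone K \<longleftrightarrow> convex_cone K \<and> interior K \<noteq> {}"

definition proper_cone :: "'a::euclidean_space set \<Rightarrow> bool" where
  "proper_cone K \<longleftrightarrow> convex_cone K \<and> closed K \<and> pointed_cone K \<and> solid_cone K"

definition polyhedral_cone :: "'a::euclidean_space set \<Rightarrow> bool" where
  "polyhedral_cone K \<longleftrightarrow> convex_cone K \<and> closed K \<and>
     (\<exists>S. finite S \<and> K = {\<Sum>v\<in>S. c v *\<^sub>R v | c. \<forall>v\<in>S. 0 \<le> c v})"

definition isomorphic_cones :: "'a::euclidean_space set \<Rightarrow> 'b::euclidean_space set \<Rightarrow> bool" where
  "isomorphic_cones K L \<longleftrightarrow> convex_cone K \<and> convex_cone L \<and> (\<exists>f. linear f \<and> bij f \<and> f ` K = L)"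

text \<open>\<open>K1\<close> and \<open>K2\<close> are arbitrary sets, not assumed to be cones; \<open>K1 + K2\<close> is the Minkowski sum.\<close>

definition reducible_cone :: "'a::euclidean_space set \<Rightarrow> bool" where
  "reducible_cone K \<longleftrightarrow> convex_cone K \<and>
     (\<exists>K1 K2. K1 \<noteq> {} \<and> K1 \<noteq> {0} \<and> K2 \<noteq> {} \<and> K2 \<noteq> {0} \<and>
        K = K1 + K2 \<and> span K1 \<inter> span K2 = {0})"

definition irreducible_cone :: "'a::euclidean_space set \<Rightarrow> bool" where
  "irreducible_cone K \<longleftrightarrow> convex_cone K \<and> K \<noteq> {0} \<and> \<not> reducible_cone K"

definition dual_cone :: "'a::euclidean_space set \<Rightarrow> 'a set" where
  "dual_cone K = {y. \<forall>x\<in>K. 0 \<le> y \<bullet> x}"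

text \<open>
  Linear transformations of V are taken from the type \<open>'a \<Rightarrow>\<^sub>L 'a\<close>, which carries a vector space
  structure. In finite dimension every linear map is bounded, so this is the space of all
  linear transformations of V (via \<open>bounded_linear_Blinfun_apply\<close> and \<open>linear_conv_bounded_linear\<close>).
\<close>

definition lyapunov_like :: "'a::euclidean_space set \<Rightarrow> ('a \<Rightarrow>\<^sub>L 'a) \<Rightarrow> bool" where
  "lyapunov_like K L \<longleftrightarrow> (\<forall>x\<in>K. \<forall>s\<in>dual_cone K. x \<bullet> s = 0 \<longrightarrow> blinfun_apply L x \<bullet> s = 0)"

definition LL :: "'a::euclidean_space set \<Rightarrow> ('a \<Rightarrow>\<^sub>L 'a) set" where
  "LL K = {L. lyapunov_like K L}"

lemma subspace_LL: "subspace (LL K)"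
  by (auto simp: subspace_def LL_def lyapunov_like_def blinfun.bilinear_simps inner_simps)

definition lyapunov_rank :: "'a::euclidean_space set \<Rightarrow> nat" where
  "lyapunov_rank K = dim (LL K)"

definition permutation_matrices :: "(real ^ 'n ^ 'n) set" where
  "permutation_matrices = {\<chi> i j. if i = p j then 1 else 0 | p. p permutes (UNIV :: 'n set)}"

definition permutation_invariant :: "(real ^ 'n) set \<Rightarrow> bool" where
  "permutation_invariant Q \<longleftrightarrow> (\<forall>A\<in>permutation_matrices. (\<lambda>x. A *v x) ` Q = Q)"

definition nonneg_orthant :: "(real ^ 'n) set" where
  "nonneg_orthant = {x. \<forall>i. 0 \<le> x $ i}"

end

theory Submission
  imports Defs
begin

text \<open>
  Fix a minimal finite generating set \<open>S\<close> of \<open>Q\<close>. Every Lyapunov-like map has each generator as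
  an eigenvector: modulo the line through a generator \<open>v\<close> the cone stays closed and pointed, so
  any \<open>w\<close> off that line is detected by an element of the dual cone orthogonal to \<open>v\<close>. Hence
  Lyapunov-like maps commute. If one of them has two eigenvalues, grouping the generators by
  eigenvalue splits \<open>Q\<close>; so for irreducible \<open>Q\<close> all of them are scalar.

  If \<open>Q\<close> is reducible, take a constant vector \<open>u\<close> in the interior (average an interior point over
  all permutations). The space of all \<open>L u\<close>, for \<open>L\<close> Lyapunov-like, is permutation invariant,
  contains \<open>u\<close>, and contains the non-constant projection of \<open>u\<close> to a direct summand; so it is the
  whole space. By commutativity \<open>L\<close> is determined by \<open>L u\<close>, which gives rank \<open>n\<close>, and the \<open>L\<close>
  with \<open>L u = v\<close>, for a generator \<open>v\<close>, has range in the line through \<open>v\<close>. Such maps separate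
  the generators, which are therefore linearly independent, and \<open>Q\<close> is simplicial.
\<close>

section \<open>Finitely generated convex cones and minimal generators\<close>

lemma convex_cone_sum:
  assumes "convex_cone K" "\<And>i. i \<in> A \<Longrightarrow> f i \<in> K"
  shows "sum f A \<in> K"
  using assms(2)
  by (induction A rule: infinite_finite_induct)
    (auto simp: assms(1) convex_cone_contains_0 convex_cone_add)

text \<open>Links the coefficient form in \<open>polyhedral_cone\<close> with hulls, whose
  monotonicity and union laws are used later.\<close>

lemma convex_cone_hull_finite:
  assumes "finite S"
  shows "convex_cone hull S = {\<Sum>v\<in>S. c v *\<^sub>R v | c. \<forall>v\<in>S. 0 \<le> c v}" (is "_ = ?R")
proof
  show "convex_cone hull S \<subseteq> ?R"
  proof (rule hull_minimal)
    show "S \<subseteq> ?R"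
    proof
      fix x assume x: "x \<in> S"
      have "x = (\<Sum>v\<in>S. (if v = x then 1 else 0) *\<^sub>R v)"
        using assms x by (simp add: if_distrib [of "\<lambda>a. a *\<^sub>R _"] cong: if_cong)
      then show "x \<in> ?R"
        by (intro CollectI exI[of _ "\<lambda>v. if v = x then 1 else 0"]) auto
    qed
    show "convex_cone ?R"
      unfolding convex_cone_iff
    proof (intro conjI ballI allI impI)
      show "0 \<in> ?R"
        by (intro CollectI exI[of _ "\<lambda>_. 0"]) auto
    next
      fix x y assume "x \<in> ?R" "y \<in> ?R"
      then obtain c d where "x = (\<Sum>v\<in>S. c v *\<^sub>R v)" "\<forall>v\<in>S. 0 \<le> c v"
        "y = (\<Sum>v\<in>S. d v *\<^sub>R v)" "\<forall>v\<in>S. 0 \<le> d v" by auto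
      then show "x + y \<in> ?R"
        by (intro CollectI exI[of _ "\<lambda>v. c v + d v"]) (auto simp: scaleR_left_distrib sum.distrib)
    next
      fix x and t :: real assume "x \<in> ?R" "0 \<le> t"
      then obtain c where "x = (\<Sum>v\<in>S. c v *\<^sub>R v)" "\<forall>v\<in>S. 0 \<le> c v" by auto
      with \<open>0 \<le> t\<close> show "t *\<^sub>R x \<in> ?R"
        by (intro CollectI exI[of _ "\<lambda>v. t * c v"]) (auto simp: scaleR_sum_right)
    qed
  qed
  show "?R \<subseteq> convex_cone hull S"
  proof clarify
    fix c assume c: "\<forall>v\<in>S. 0 \<le> (c v :: real)"
    then show "(\<Sum>v\<in>S. c v *\<^sub>R v) \<in> convex_cone hull S"
      by (intro convex_cone_sum convex_cone_convex_cone_hull convex_cone_hull_mul) (auto simp: hull_inc)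
  qed
qed

text \<open>Deleting a redundant generator leaves the hull unchanged, and finiteness makes repeated
  deletion stop.\<close>

lemma ex_minimal_cone_generators:
  assumes "finite S"
  obtains T where "finite T" "convex_cone hull T = convex_cone hull S"
    "\<And>v. v \<in> T \<Longrightarrow> v \<notin> convex_cone hull (T - {v})"
proof -
  from assms have "\<exists>T. finite T \<and> convex_cone hull T = convex_cone hull S \<and>
    (\<forall>v\<in>T. v \<notin> convex_cone hull (T - {v}))"
  proof (induction S rule: finite_psubset_induct)
    case (psubset S)
    show ?case
    proof (cases "\<exists>v\<in>S. v \<in> convex_cone hull (S - {v})")
      case True
      then obtain v where v: "v \<in> S" "v \<in> convex_cone hull (S - {v})" by blast
      then have "convex_cone hull (S - {v}) = convex_cone hull S"
        by (metis hull_redundant insert_Diff)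
      with psubset.IH[of "S - {v}"] v show ?thesis
        by auto
    next
      case False
      with psubset.hyps show ?thesis by blast
    qed
  qed
  then show ?thesis using that by blast
qed

lemma convex_cone_hull_subset_span: "convex_cone hull S \<subseteq> span S"
  by (simp add: convex_cone_span hull_minimal span_superset)

section \<open>Pointed and solid cones, separation, eigenvectors\<close>

lemma pointed_coneD:
  assumes "pointed_cone K" "x \<in> K" "- x \<in> K"
  shows "x = 0"
proof -
  have "x \<in> uminus ` K"
    using assms(3) by (rule rev_image_eqI) simp
  with assms show ?thesis
    unfolding pointed_cone_def by blast
qed

lemma span_solid_cone:
  assumes "solid_cone K"
  shows "span K = UNIV"
proof -
  have "K \<subseteq> span K" by (rule span_superset)
  then have "interior (span K) \<noteq> {}"
    using assms interior_mono[of K "span K"] by (auto simp: solid_cone_def)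
  then show ?thesis
    by (metis dim_eq_full dim_span dim_subset_UNIV empty_interior_lowdim le_neq_implies_less span_span)
qed

lemma separate_convex_cone:
  fixes T :: "'a::euclidean_space set"
  assumes "convex_cone T" "closed T" "w \<notin> T"
  obtains s where "s \<in> dual_cone T" "s \<bullet> w < 0"
proof -
  obtain a b where ab: "a \<bullet> w < b" "\<And>x. x \<in> T \<Longrightarrow> b < a \<bullet> x"
    using separating_hyperplane_closed_point[of T w] assms by (auto simp: convex_cone_def)
  have b: "b < 0"
    using ab(2)[of 0] convex_cone_contains_0[OF assms(1)] by simp
  have "0 \<le> a \<bullet> x" if "x \<in> T" for x
  proof (rule ccontr)
    assume neg: "\<not> 0 \<le> a \<bullet> x"
    \<comment> \<open>The scaling factor is positive and makes the inner product with
      \<open>a\<close> exactly \<open>b\<close>, against the strict bound.\<close>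
    then have "(b / (a \<bullet> x)) *\<^sub>R x \<in> T"
      using that b assms(1) by (intro convex_cone_scaleR) (auto simp: divide_nonpos_neg)
    from ab(2)[OF this] neg show False by simp
  qed
  with ab b that show ?thesis by (force simp: dual_cone_def)
qed

text \<open>\<open>S\<close> contains a basis of its span, and in it \<open>f\<close> scales every
  coordinate by a nonzero factor.\<close>

lemma inj_on_span_eigenvectors:
  assumes "linear f" "\<And>v. v \<in> S \<Longrightarrow> \<exists>c. c \<noteq> 0 \<and> f v = c *\<^sub>R v" "x \<in> span S" "f x = 0"
  shows "x = 0"
proof -
  obtain B where B: "B \<subseteq> S" "independent B" "S \<subseteq> span B"
    by (metis basis_exists)
  have "x \<in> span B"
    using B(3) assms(3) span_minimal subspace_span by blast
  then obtain T a where T: "finite T" "T \<subseteq> B" "x = (\<Sum>v\<in>T. a v *\<^sub>R v)"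
    by (auto simp: span_explicit)
  obtain c where c: "\<And>v. v \<in> S \<Longrightarrow> c v \<noteq> 0 \<and> f v = c v *\<^sub>R v"
    using assms(2) by metis
  have "0 = (\<Sum>v\<in>T. a v *\<^sub>R f v)"
    using assms T by (simp add: linear_sum linear_cmul)
  also have "\<dots> = (\<Sum>v\<in>T. (a v * c v) *\<^sub>R v)"
    using c T(2) B(1) by (intro sum.cong) auto
  finally have "\<forall>v\<in>T. a v * c v = 0"
    using independentD[OF B(2) T(1,2)] by metis
  then have "\<forall>v\<in>T. a v = 0"
    using c T(2) B(1) by auto
  then show ?thesis using T(3) by simp
qed

section \<open>Lyapunov-like maps and minimal generators\<close>

text \<open>Solidity enters as \<open>span S = UNIV\<close>, so a linear map is determined by its
  values on the generators.\<close>

locale minimal_cone_generators =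
  fixes Q S :: "'a::euclidean_space set"
  assumes fin: "finite S"
    and Q_eq: "Q = convex_cone hull S"
    and pointed: "\<And>x. x \<in> Q \<Longrightarrow> - x \<in> Q \<Longrightarrow> x = 0"
    and minimal: "\<And>v. v \<in> S \<Longrightarrow> v \<notin> convex_cone hull (S - {v})"
    and span_S: "span S = UNIV"
begin

lemma convex_cone_Q: "convex_cone Q"
  by (simp add: Q_eq convex_cone_convex_cone_hull)

lemma gen_in_Q: "v \<in> S \<Longrightarrow> v \<in> Q"
  by (simp add: Q_eq hull_inc)

lemma zero_notin_gens: "0 \<notin> S"
  using minimal convex_cone_hull_contains_0 by blast

text \<open>A nonnegative ratio would make one generator redundant; a negative one would put it and
  its negative in \<open>Q\<close>.\<close>

lemma gens_not_parallel:
  assumes "v \<in> S" "w \<in> S" "v \<noteq> w" "x \<in> span {v}" "x \<in> span {w}"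
  shows "x = 0"
proof (rule ccontr)
  assume "x \<noteq> 0"
  obtain a where a: "x = a *\<^sub>R v"
    using assms by (auto simp: span_singleton)
  obtain b where b: "x = b *\<^sub>R w"
    using assms by (auto simp: span_singleton)
  have "v = (1 / a) *\<^sub>R x"
    using a \<open>x \<noteq> 0\<close> by auto
  then have v: "v = (b / a) *\<^sub>R w"
    by (simp add: b)
  show False
  proof (cases "0 \<le> b / a")
    case True
    then have "v \<in> convex_cone hull (S - {v})"
      using v assms by (metis DiffI convex_cone_hull_mul hull_inc singletonD)
    with minimal assms show False by blast
  next
    case False
    then have "- v \<in> Q"
      using v convex_cone_scaleR[OF convex_cone_Q, of "- (b / a)" w] assms gen_in_Q by simp
    then have "v = 0"
      using pointed gen_in_Q assms by blast
    with zero_notin_gens assms show False by blast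
  qed
qed

text \<open>A generator of a minimal system spans a face: modulo the line through it the cone stays pointed.\<close>

lemma lineality_insert_minus:
  assumes v: "v \<in> S"
    and w: "w \<in> convex_cone hull (insert (- v) S)" "- w \<in> convex_cone hull (insert (- v) S)"
  shows "w \<in> span {v}"
proof -
  let ?H = "convex_cone hull (S - {v})"
  have HQ: "?H \<subseteq> Q"
    unfolding Q_eq by (intro hull_mono) auto
  \<comment> \<open>\<open>v\<close> and \<open>- v\<close> together generate the line through
    \<open>v\<close>, so only the sign constraint on its coefficient is lost.\<close>
  have decomp: "\<exists>x\<in>?H. \<exists>a. y = x + a *\<^sub>R v" if "y \<in> convex_cone hull (insert (- v) S)" for y
  proof -
    have "insert (- v) S = (S - {v}) \<union> {v, - v}" using v by auto
    with that obtain x z where xz: "x \<in> ?H" "z \<in> convex_cone hull {v, - v}" "y = x + z"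
      using convex_cone_hull_Un[of "S - {v}" "{v, - v}"] by auto
    have "convex_cone hull {v, - v} \<subseteq> span {v}"
      by (intro hull_minimal convex_cone_span) (auto simp: span_base span_neg)
    with xz(2) obtain a where "z = a *\<^sub>R v"
      by (auto simp: span_singleton)
    with xz show ?thesis by blast
  qed
  obtain x a where x: "x \<in> ?H" "w = x + a *\<^sub>R v" using decomp[OF w(1)] by blast
  obtain y b where y: "y \<in> ?H" "- w = y + b *\<^sub>R v" using decomp[OF w(2)] by blast
  have xy: "x + y \<in> ?H"
    by (simp add: convex_cone_hull_add x y)
  have eq: "x + y = - (a + b) *\<^sub>R v"
  proof -
    have "x = w - a *\<^sub>R v" "y = - w - b *\<^sub>R v"
      using x(2) y(2) by simp_all
    then show ?thesis by (simp add: algebra_simps)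
  qed
  \<comment> \<open>If \<open>a + b\<close> is negative, \<open>v\<close> is a nonnegative multiple
    of \<open>x + y\<close> and hence redundant; otherwise \<open>x + y\<close> and its negative
    both lie in \<open>Q\<close>.\<close>
  have "x + y = 0"
  proof (cases "a + b < 0")
    case True
    then have "v = (1 / - (a + b)) *\<^sub>R (x + y)"
      unfolding eq scaleR_scaleR by simp
    then have "v \<in> ?H"
      using True convex_cone_hull_mul[OF xy, of "1 / - (a + b)"] by simp
    with minimal v show ?thesis by blast
  next
    case False
    then have "(a + b) *\<^sub>R v \<in> Q"
      using convex_cone_scaleR[OF convex_cone_Q, of "a + b" v] v gen_in_Q by simp
    moreover have "- ((a + b) *\<^sub>R v) = x + y"
      unfolding eq by (metis scaleR_minus_left)
    ultimately show ?thesis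
      using pointed xy HQ by (metis neg_equal_0_iff_equal subsetD)
  qed
  then have "y = - x"
    by (simp add: eq_neg_iff_add_eq_0 add.commute)
  then have "- x \<in> Q" "x \<in> Q"
    using x(1) y(1) HQ by auto
  then have "x = 0" using pointed by blast
  with x show ?thesis by (simp add: span_base span_scale)
qed

lemma lyapunov_like_eigenvector:
  assumes L: "L \<in> LL Q" and v: "v \<in> S"
  shows "blinfun_apply L v \<in> span {v}"
proof (rule ccontr)
  let ?T = "convex_cone hull (insert (- v) S)"
  let ?w = "blinfun_apply L v"
  assume "?w \<notin> span {v}"
  \<comment> \<open>\<open>?w\<close> and \<open>- ?w\<close> cannot both lie in the enlarged cone;
    the one outside is separated from it.\<close>
  then obtain w where w: "w \<notin> ?T" "w = ?w \<or> w = - ?w"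
    using lineality_insert_minus[OF v] by blast
  then obtain s where s: "s \<in> dual_cone ?T" "s \<bullet> w < 0"
    using separate_convex_cone[OF convex_cone_convex_cone_hull closed_convex_cone_hull] fin by blast
  \<comment> \<open>Both \<open>v\<close> and \<open>- v\<close> lie in the enlarged cone, so
    \<open>s\<close> vanishes on \<open>v\<close> and the Lyapunov-like condition applies to this
    pair.\<close>
  have "s \<bullet> - v \<ge> 0" "s \<bullet> v \<ge> 0"
    using s(1) v unfolding dual_cone_def by (blast intro: hull_inc)+
  then have "v \<bullet> s = 0"
    by (simp add: inner_commute)
  moreover have "s \<in> dual_cone Q"
    using s(1) hull_mono[of S "insert (- v) S" convex_cone] by (auto simp: dual_cone_def Q_eq)
  ultimately have "?w \<bullet> s = 0"
    using L v gen_in_Q by (auto simp: LL_def lyapunov_like_def)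
  with s(2) w(2) show False by (auto simp: inner_commute)
qed

lemma blinfun_eqI_gens:
  assumes "\<And>v. v \<in> S \<Longrightarrow> blinfun_apply L v = blinfun_apply M v"
  shows "blinfun_apply L x = blinfun_apply M x"
proof (rule linear_eq_on[of "blinfun_apply L" "blinfun_apply M"])
  show "linear (blinfun_apply L)" "linear (blinfun_apply M)"
    by (simp_all add: blinfun.bounded_linear_right bounded_linear.linear)
  show "x \<in> span S" using span_S by auto
qed (use assms in auto)

text \<open>Each generator is a common eigenvector, and the generators span.\<close>

lemma LL_commute:
  assumes L: "L \<in> LL Q" and M: "M \<in> LL Q"
  shows "blinfun_apply L (blinfun_apply M x) = blinfun_apply M (blinfun_apply L x)"
proof -
  have "blinfun_apply (L o\<^sub>L M) x = blinfun_apply (M o\<^sub>L L) x"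
  proof (rule blinfun_eqI_gens)
    fix v assume "v \<in> S"
    then have "blinfun_apply L v \<in> span {v}" "blinfun_apply M v \<in> span {v}"
      by (simp_all add: lyapunov_like_eigenvector L M)
    then show "blinfun_apply (L o\<^sub>L M) v = blinfun_apply (M o\<^sub>L L) v"
      by (auto simp: span_singleton blinfun.scaleR_right)
  qed
  then show ?thesis by simp
qed

lemma irreducible_LL_scalar:
  assumes irr: "irreducible_cone Q" and L: "L \<in> LL Q"
  shows "\<exists>c. L = c *\<^sub>R id_blinfun"
proof -
  obtain v0 where v0: "v0 \<in> S"
    using irr Q_eq convex_cone_hull_empty by (metis all_not_in_conv irreducible_cone_def)
  obtain c where c: "blinfun_apply L v0 = c *\<^sub>R v0"
    using lyapunov_like_eigenvector[OF L v0] by (auto simp: span_singleton)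
  \<comment> \<open>The eigenvalue at one generator is subtracted, so \<open>S1\<close> collects the
    generators sharing it and \<open>S2\<close> the rest.\<close>
  define f where "f = (\<lambda>x. blinfun_apply L x - c *\<^sub>R x)"
  have lin: "linear f"
    unfolding f_def
    by (intro linear_compose_sub bounded_linear.linear blinfun.bounded_linear_right
        bounded_linear_scaleR_right)
  define S1 where "S1 = {v\<in>S. f v = 0}"
  define S2 where "S2 = {v\<in>S. f v \<noteq> 0}"
  let ?K1 = "convex_cone hull S1" and ?K2 = "convex_cone hull S2"
  have "S2 = {}"
  proof (rule ccontr)
    assume "S2 \<noteq> {}"
    then obtain v2 where v2: "v2 \<in> S2" by blast
    have "S = S1 \<union> S2" by (auto simp: S1_def S2_def)
    then have "Q = ?K1 + ?K2"
      by (auto simp: Q_eq convex_cone_hull_Un set_plus_def)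
    moreover have "v0 \<in> ?K1" "v0 \<noteq> 0" "v2 \<in> ?K2" "v2 \<noteq> 0"
      using v0 c v2 zero_notin_gens by (auto simp: S1_def S2_def f_def hull_inc)
    then have "?K1 \<noteq> {}" "?K1 \<noteq> {0}" "?K2 \<noteq> {}" "?K2 \<noteq> {0}" by auto
    moreover have "span ?K1 \<inter> span ?K2 = {0}"
    proof -
      \<comment> \<open>\<open>f\<close> vanishes on the first span and is injective on the
        second.\<close>
      have "x = 0" if x: "x \<in> span ?K1" "x \<in> span ?K2" for x
      proof (rule inj_on_span_eigenvectors[OF lin])
        have "span ?K1 \<subseteq> span S1" "span ?K2 \<subseteq> span S2"
          by (intro span_minimal convex_cone_hull_subset_span subspace_span)+
        then have xs: "x \<in> span S1" "x \<in> span S2" using x by auto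
        show "x \<in> span S2" by fact
        show "f x = 0"
          using xs(1) by (rule linear_eq_0_on_span[OF lin, rotated]) (auto simp: S1_def)
        fix v assume v: "v \<in> S2"
        then obtain d where "blinfun_apply L v = d *\<^sub>R v"
          using lyapunov_like_eigenvector[OF L, of v] by (auto simp: S2_def span_singleton)
        with v have "f v = (d - c) *\<^sub>R v" "d - c \<noteq> 0"
          by (auto simp: f_def S2_def algebra_simps)
        then show "\<exists>c. c \<noteq> 0 \<and> f v = c *\<^sub>R v" by blast
      qed
      then show ?thesis by (auto simp: span_zero)
    qed
    ultimately have "reducible_cone Q"
      unfolding reducible_cone_def using convex_cone_Q by blast
    with irr show False by (simp add: irreducible_cone_def)
  qed
  have "blinfun_apply L x = blinfun_apply (c *\<^sub>R id_blinfun) x" for x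
  proof (rule blinfun_eqI_gens)
    fix v assume "v \<in> S"
    then have "f v = 0" using \<open>S2 = {}\<close> by (auto simp: S2_def)
    then show "blinfun_apply L v = blinfun_apply (c *\<^sub>R id_blinfun) v"
      by (simp add: f_def blinfun.scaleR_left)
  qed
  then have "L = c *\<^sub>R id_blinfun" by (rule blinfun_eqI)
  then show ?thesis ..
qed

lemma irreducible_lyapunov_rank:
  assumes irr: "irreducible_cone Q"
  shows "lyapunov_rank Q = 1"
proof -
  have "id_blinfun \<in> LL Q"
    by (auto simp: LL_def lyapunov_like_def)
  moreover have "LL Q \<subseteq> span {id_blinfun}"
    using irreducible_LL_scalar[OF irr] by (auto simp: span_singleton)
  moreover have "id_blinfun \<noteq> (0 :: 'a \<Rightarrow>\<^sub>L 'a)"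
    by (metis blinfun_apply_id_blinfun id_apply nonzero_Basis SOME_Basis zero_blinfun.rep_eq)
  ultimately show ?thesis
    using basis_card_eq_dim[of "{id_blinfun}" "LL Q"] by (simp add: lyapunov_rank_def)
qed

text \<open>Evaluation at \<open>u\<close> is an isomorphism from \<open>LL Q\<close> onto the whole
  space. It is injective because \<open>L u = 0\<close> gives \<open>L (M u) = M (L u) = 0\<close>,
  and every vector is some \<open>M u\<close>.\<close>

lemma lyapunov_rank_transitive:
  assumes trans: "\<And>x. \<exists>L\<in>LL Q. blinfun_apply L u = x"
  shows "lyapunov_rank Q = DIM('a)"
proof -
  define ev where "ev = (\<lambda>L :: 'a \<Rightarrow>\<^sub>L 'a. blinfun_apply L u)"
  have lin: "linear ev"
    unfolding ev_def by (intro bounded_linear.linear blinfun.bounded_linear_left)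
  have kernel: "L = 0" if L: "L \<in> LL Q" "ev L = 0" for L
  proof (rule blinfun_eqI)
    fix x
    obtain M where "M \<in> LL Q" "blinfun_apply M u = x" using trans by blast
    then show "blinfun_apply L x = blinfun_apply 0 x"
      using LL_commute[OF L(1), of M u] L(2) by (simp add: ev_def)
  qed
  obtain B where B: "B \<subseteq> LL Q" "independent B" "LL Q \<subseteq> span B" "card B = dim (LL Q)"
    by (rule basis_exists)
  have span_B: "span B = LL Q"
    using B span_minimal[OF B(1) subspace_LL] by auto
  have inj: "inj_on ev (span B)"
  proof (rule inj_onI)
    fix L M assume "L \<in> span B" "M \<in> span B" "ev L = ev M"
    then have "L - M \<in> LL Q" "ev (L - M) = 0"
      using linear_diff[OF lin] subspace_diff[OF subspace_LL] by (auto simp: span_B)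
    then show "L = M" using kernel by fastforce
  qed
  have "independent (ev ` B)"
    using linear_independent_injective_image[OF lin B(2) inj] .
  moreover have "span (ev ` B) = UNIV"
    unfolding linear_span_image[OF lin] span_B using trans by (metis UNIV_eq_I ev_def imageI)
  ultimately have "card (ev ` B) = DIM('a)"
    using basis_card_eq_dim[of "ev ` B" UNIV] by simp
  moreover have "card (ev ` B) = card B"
    using inj by (metis card_image inj_on_subset span_superset)
  ultimately show ?thesis
    using B(4) by (simp add: lyapunov_rank_def)
qed

lemma independent_gens_transitive:
  assumes trans: "\<And>x. \<exists>L\<in>LL Q. blinfun_apply L u = x"
  shows "independent S"
proof -
  have coeff: "c v = 0" if v: "v \<in> S" and c: "(\<Sum>w\<in>S. c w *\<^sub>R w) = 0" for c v
  proof -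
    obtain L where L: "L \<in> LL Q" "blinfun_apply L u = v" using trans by blast
    \<comment> \<open>With \<open>x = M u\<close>, commutation gives
      \<open>L x = M (L u) = M v\<close>, and \<open>v\<close> is an eigenvector of
      \<open>M\<close>.\<close>
    have range: "blinfun_apply L x \<in> span {v}" for x
    proof -
      obtain M where M: "M \<in> LL Q" "blinfun_apply M u = x" using trans by blast
      then have "blinfun_apply L x = blinfun_apply M v"
        using LL_commute[OF L(1) M(1), of u] L(2) by simp
      then show ?thesis
        using lyapunov_like_eigenvector[OF M(1) v] by simp
    qed
    \<comment> \<open>\<open>L w\<close> lies on the line through \<open>w\<close>, its own
      eigenline, and on the line through \<open>v\<close> by \<open>range\<close>.\<close>
    have other: "blinfun_apply L w = 0" if "w \<in> S" "w \<noteq> v" for w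
      using gens_not_parallel[of v w] that v range lyapunov_like_eigenvector[OF L(1)] by metis
    have nz: "blinfun_apply L v \<noteq> 0"
    proof
      assume Lv: "blinfun_apply L v = 0"
      have "blinfun_apply L u = blinfun_apply 0 u"
      proof (rule blinfun_eqI_gens)
        fix w assume "w \<in> S"
        then show "blinfun_apply L w = blinfun_apply 0 w"
          using other Lv by (cases "w = v") auto
      qed
      with L(2) v zero_notin_gens show False by simp
    qed
    \<comment> \<open>Applying \<open>L\<close> to the linear relation isolates the coefficient of
      \<open>v\<close>.\<close>
    have "0 = (\<Sum>w\<in>S. c w *\<^sub>R blinfun_apply L w)"
      using arg_cong[OF c, of "blinfun_apply L"]
      by (simp add: blinfun.sum_right blinfun.scaleR_right)
    also have "\<dots> = (\<Sum>w\<in>{v}. c w *\<^sub>R blinfun_apply L w)"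
      using fin v other by (intro sum.mono_neutral_right) auto
    finally show ?thesis using nz by simp
  qed
  then show ?thesis
    using dependent_finite[OF fin] by blast
qed

end

section \<open>Simplicial cones and the orthant\<close>

text \<open>\<open>S\<close> is a basis; sending it to the standard basis carries its hull to the
  hull of the axis vectors, which is the orthant.\<close>

lemma isomorphic_cones_orthant:
  fixes S :: "(real ^ 'n) set"
  assumes "independent S" "span S = UNIV"
  shows "isomorphic_cones (convex_cone hull S) (nonneg_orthant :: (real ^ 'n) set)"
proof -
  have "finite S" "card S = CARD('n)"
    using assms basis_card_eq_dim[of S UNIV] by (auto simp: independent_imp_finite)
  then obtain g where g: "bij_betw g S (UNIV :: 'n set)"
    by (metis finite_same_card_bij finite_class.finite_UNIV)
  obtain f :: "real ^ 'n \<Rightarrow> real ^ 'n"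
    where f: "linear f" "\<And>v. v \<in> S \<Longrightarrow> f v = axis (g v) 1"
    using linear_independent_extend[OF assms(1), of "\<lambda>v. axis (g v) 1"] by blast
  let ?E = "range (\<lambda>i::'n. axis i 1 :: real ^ 'n)"
  have image: "f ` S = ?E"
  proof -
    have "f ` S = (\<lambda>i. axis i 1) ` g ` S"
      unfolding image_image using f(2) by (rule image_cong[OF refl])
    then show ?thesis using g by (simp add: bij_betw_def)
  qed
  have expand: "x = (\<Sum>i\<in>UNIV. x $ i *\<^sub>R axis i 1)" for x :: "real ^ 'n"
    using basis_expansion[of x] by (simp add: scalar_mult_eq_scaleR)
  have "x \<in> span ?E" for x :: "real ^ 'n"
    by (subst expand) (intro span_sum span_scale span_base rangeI)
  then have "surj f"
    using linear_span_image[OF f(1), of S] assms(2) image by auto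
  then have bij: "bij f"
    using f(1) by (simp add: bij_def linear_surjective_imp_injective)
  have orthant: "convex_cone (nonneg_orthant :: (real ^ 'n) set)"
    by (auto simp: convex_cone_iff nonneg_orthant_def)
  have "convex_cone hull ?E = nonneg_orthant"
  proof
    show "convex_cone hull ?E \<subseteq> nonneg_orthant"
      by (intro hull_minimal orthant) (auto simp: nonneg_orthant_def axis_def)
    show "nonneg_orthant \<subseteq> convex_cone hull ?E"
    proof
      fix x :: "real ^ 'n" assume "x \<in> nonneg_orthant"
      then show "x \<in> convex_cone hull ?E"
        by (subst expand)
          (auto simp: nonneg_orthant_def hull_inc
            intro!: convex_cone_sum convex_cone_convex_cone_hull convex_cone_hull_mul)
    qed
  qed
  then have "f ` (convex_cone hull S) = nonneg_orthant"
    using convex_cone_hull_linear_image[OF f(1), of S] image by simp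
  then show ?thesis
    unfolding isomorphic_cones_def using f(1) bij orthant convex_cone_convex_cone_hull by blast
qed

section \<open>Direct sum decompositions of cones\<close>

lemma direct_sum_unique:
  assumes "span K1 \<inter> span K2 = {0}" "a + b = a' + b'"
    and "a \<in> span K1" "a' \<in> span K1" "b \<in> span K2" "b' \<in> span K2"
  shows "a = a'" "b = b'"
proof -
  have "a - a' = b' - b"
    using assms(2) by (metis add_diff_cancel_left' add_diff_eq diff_add_cancel diff_diff_eq2)
  then have "a - a' \<in> span K1 \<inter> span K2"
    using assms by (metis IntI span_diff)
  then show "a = a'" using assms(1) by auto
  then show "b = b'" using assms(2) by auto
qed

text \<open>The summands are arbitrary sets, so that each contains 0 must be derived: uniqueness of
  components forces both parts of 0 to vanish.\<close>

lemma direct_sum_components_subset: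
  assumes "0 \<in> K1 + K2" "span K1 \<inter> span K2 = {0}"
  shows "K1 \<subseteq> K1 + K2" "K2 \<subseteq> K1 + K2"
proof -
  obtain a b where ab: "a \<in> K1" "b \<in> K2" "a + b = 0"
    using assms(1) by (auto simp: set_plus_def)
  have "a = 0" "b = 0"
    using direct_sum_unique[OF assms(2), of a b 0 0] ab by (auto simp: span_base span_zero)
  then have "0 \<in> K1" "0 \<in> K2" using ab by auto
  then show "K1 \<subseteq> K1 + K2" "K2 \<subseteq> K1 + K2"
    using set_plus_intro[of _ K1 0 K2] set_plus_intro[of 0 K1 _ K2] by auto
qed

text \<open>Were \<open>a\<close> zero, moving \<open>b\<close> slightly along \<open>- k\<close>
  for a nonzero \<open>k\<close> in \<open>K1\<close> would stay in \<open>K\<close>; its first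
  component, a negative multiple of \<open>k\<close>, would then lie in \<open>K\<close>, against
  pointedness.\<close>

lemma interior_component_nonzero:
  fixes K :: "'a::euclidean_space set"
  assumes K: "K = K1 + K2" "span K1 \<inter> span K2 = {0}" "pointed_cone K"
    and K1: "K1 \<noteq> {}" "K1 \<noteq> {0}"
    and a: "a \<in> K1" and b: "b \<in> K2" and int: "a + b \<in> interior K"
  shows "a \<noteq> 0"
proof
  assume a0: "a = 0"
  have cone: "convex_cone K" using K by (simp add: pointed_cone_def)
  have "K1 \<subseteq> K"
    using direct_sum_components_subset(1)[of K1 K2] K cone convex_cone_contains_0 by blast
  obtain k where k: "k \<in> K1" "k \<noteq> 0" using K1 by blast
  obtain e where e: "e > 0" "ball b e \<subseteq> K"
    using int a0 by (auto simp: mem_interior)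
  \<comment> \<open>The displacement by \<open>t\<close> times \<open>k\<close> has length
    \<open>e / 2\<close>, inside the open ball.\<close>
  define t where "t = e / (2 * norm k)"
  have t: "t > 0" "t * norm k < e"
    using e k by (auto simp: t_def)
  have "b - t *\<^sub>R k \<in> K"
    using e(2) t by (auto simp: dist_norm)
  then have "- (t *\<^sub>R k) + b \<in> K1 + K2"
    by (simp add: K(1))
  then obtain a' b' where ab: "a' \<in> K1" "b' \<in> K2" "- (t *\<^sub>R k) + b = a' + b'"
    by (rule set_plus_elim)
  have "- (t *\<^sub>R k) = a'"
    by (rule direct_sum_unique(1)[OF K(2) ab(3)])
      (use ab k b in \<open>simp_all add: span_base span_neg span_scale\<close>)
  then have "- (t *\<^sub>R k) \<in> K"
    using ab(1) \<open>K1 \<subseteq> K\<close> by auto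
  moreover have "t *\<^sub>R k \<in> K"
    using \<open>K1 \<subseteq> K\<close> k(1) t(1) cone by (intro convex_cone_scaleR) auto
  ultimately have "t *\<^sub>R k = 0"
    using pointed_coneD K(3) by blast
  with t k show False by simp
qed

text \<open>The witness is the projection onto a direct summand, which is Lyapunov-like.\<close>

lemma reducible_LL_not_scalar:
  fixes K :: "'a::euclidean_space set"
  assumes red: "reducible_cone K" and pointed: "pointed_cone K" and u: "u \<in> interior K"
  obtains L where "L \<in> LL K" "blinfun_apply L u \<notin> span {u}"
proof -
  obtain K1 K2 where K: "K = K1 + K2" "span K1 \<inter> span K2 = {0}"
    and K1: "K1 \<noteq> {}" "K1 \<noteq> {0}" and K2: "K2 \<noteq> {}" "K2 \<noteq> {0}" and cone: "convex_cone K"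
    using red by (auto simp: reducible_cone_def)
  have sub: "K1 \<subseteq> K" "K2 \<subseteq> K"
    using direct_sum_components_subset[of K1 K2] K cone convex_cone_contains_0 by blast+
  have "K \<subseteq> span (K1 \<union> K2)"
    unfolding K(1) by (auto elim!: set_plus_elim intro!: span_add intro: span_base)
  moreover have "span K = UNIV"
    using u cone by (intro span_solid_cone) (auto simp: solid_cone_def)
  ultimately have "span (K1 \<union> K2) = UNIV"
    by (metis UNIV_eq_I UNIV_I span_minimal subspace_span subsetD)
  have "\<exists>a b. a \<in> span K1 \<and> b \<in> span K2 \<and> x = a + b" for x
  proof -
    have "x \<in> {a + b |a b. a \<in> span K1 \<and> b \<in> span K2}"
      using \<open>span (K1 \<union> K2) = UNIV\<close> by (simp flip: span_Un)
    then show ?thesis by blast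
  qed
  then obtain P R where PR: "\<And>x. P x \<in> span K1" "\<And>x. R x \<in> span K2" "\<And>x. x = P x + R x"
    by metis
  \<comment> \<open>Uniqueness of components makes the chosen \<open>P\<close> the projection along
    \<open>span K2\<close>, hence linear.\<close>
  have P_eq: "P (a + b) = a" if "a \<in> span K1" "b \<in> span K2" for a b
    using direct_sum_unique(1)[OF K(2), of "P (a + b)" "R (a + b)" a b] that PR by simp
  have lin: "linear P"
  proof (rule linearI)
    fix x y
    have "P ((P x + P y) + (R x + R y)) = P x + P y"
      by (intro P_eq span_add PR)
    moreover have "x + y = (P x + P y) + (R x + R y)"
      using PR(3)[of x] PR(3)[of y] by (simp add: algebra_simps)
    ultimately show "P (x + y) = P x + P y" by simp
  next
    fix c x
    have "P (c *\<^sub>R P x + c *\<^sub>R R x) = c *\<^sub>R P x"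
      by (intro P_eq span_scale PR)
    then show "P (c *\<^sub>R x) = c *\<^sub>R P x"
      using PR(3)[of x] by (metis scaleR_right_distrib)
  qed
  define L where "L = Blinfun P"
  have L: "blinfun_apply L = P"
    using lin by (simp add: L_def bounded_linear_Blinfun_apply linear_conv_bounded_linear)
  have "x \<in> K \<Longrightarrow> s \<in> dual_cone K \<Longrightarrow> x \<bullet> s = 0 \<Longrightarrow> P x \<bullet> s = 0" for x s
  proof -
    assume x: "x \<in> K" and s: "s \<in> dual_cone K" and xs: "x \<bullet> s = 0"
    obtain a b where ab: "a \<in> K1" "b \<in> K2" "x = a + b"
      using x K(1) by (auto simp: set_plus_def)
    have "P x = a" using ab P_eq by (simp add: span_base)
    \<comment> \<open>Both parts pair nonnegatively with \<open>s\<close>, so the pairings can sum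
      to 0 only if each is 0.\<close>
    moreover have "0 \<le> s \<bullet> a" "0 \<le> s \<bullet> b"
      using ab sub s by (auto simp: dual_cone_def)
    moreover have "s \<bullet> a + s \<bullet> b = 0"
      using xs ab(3) by (simp add: inner_add_right inner_commute[of _ s])
    ultimately show ?thesis
      by (simp add: inner_commute[of _ s])
  qed
  then have "L \<in> LL K"
    by (auto simp: LL_def lyapunov_like_def L)
  moreover have "blinfun_apply L u \<notin> span {u}"
  proof
    assume "blinfun_apply L u \<in> span {u}"
    then obtain c where c: "P u = c *\<^sub>R u"
      by (auto simp: L span_singleton)
    obtain a b where ab: "a \<in> K1" "b \<in> K2" "u = a + b"
      using u interior_subset K(1) by (force simp: set_plus_def)
    have "P u = a" using ab P_eq by (simp add: span_base)
    then have "a + 0 = c *\<^sub>R a + c *\<^sub>R b"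
      using c ab(3) by (simp add: scaleR_right_distrib)
    then have "a = c *\<^sub>R a" "0 = c *\<^sub>R b"
      using direct_sum_unique[OF K(2), of a 0 "c *\<^sub>R a" "c *\<^sub>R b"] ab
      by (auto simp: span_base span_scale span_zero)
    \<comment> \<open>A nonzero \<open>a\<close> forces \<open>c = 1\<close> and a nonzero
      \<open>b\<close> forces \<open>c = 0\<close>, yet an interior point has both components
      nonzero.\<close>
    then have "a = 0 \<or> b = 0" by auto
    moreover have "a \<noteq> 0"
      using interior_component_nonzero[OF K pointed K1 ab(1,2)] u ab(3) by simp
    moreover have "b \<noteq> 0"
      using interior_component_nonzero[of K K2 K1 b a] K pointed K2 ab u
      by (simp add: add.commute Int_commute)
    ultimately show False by blast
  qed
  ultimately show ?thesis using that by blast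
qed

section \<open>Permutation symmetry\<close>

lemma permutation_invariant_coords:
  fixes Q :: "(real ^ 'n) set"
  assumes "permutation_invariant Q" "p permutes UNIV" "x \<in> Q"
  shows "(\<chi> i. x $ p i) \<in> Q"
proof -
  \<comment> \<open>The permutation matrix of \<open>p\<close> moves coordinate \<open>j\<close> to
    position \<open>p j\<close>, so reading coordinates at \<open>p i\<close> takes the
    inverse.\<close>
  let ?A = "(\<chi> i j. if i = inv p j then 1 else 0) :: real ^ 'n ^ 'n"
  have iff: "i = inv p j \<longleftrightarrow> j = p i" for i j
    using permutes_inv_eq[OF assms(2)] by metis
  have "?A *v x = (\<chi> i. x $ p i)"
    by (simp add: matrix_vector_mult_def iff vec_eq_iff if_distrib[of "\<lambda>a. a * _"] cong: if_cong)
  moreover have "?A \<in> permutation_matrices"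
    using permutes_inv[OF assms(2)] by (auto simp: permutation_matrices_def)
  ultimately show ?thesis
    using assms unfolding permutation_invariant_def by (metis imageI)
qed

text \<open>Swapping two unequal coordinates isolates \<open>axis i 1 - axis j 1\<close>; further
  swaps give every \<open>axis i 1 - axis l 1\<close>, and adding the constant vector yields the
  standard basis.\<close>

lemma transposition_invariant_subspace_UNIV:
  fixes W :: "(real ^ 'n) set"
  assumes W: "subspace W"
    and inv: "\<And>i j x. x \<in> W \<Longrightarrow> (\<chi> k. x $ Transposition.transpose i j k) \<in> W"
    and one: "vec 1 \<in> W"
    and x: "x \<in> W" "x $ i \<noteq> x $ j"
  shows "W = UNIV"
proof -
  have "x - (\<chi> k. x $ Transposition.transpose i j k) = (x $ i - x $ j) *\<^sub>R (axis i 1 - axis j 1)"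
    by (auto simp: vec_eq_iff axis_def Transposition.transpose_def)
  then have "(x $ i - x $ j) *\<^sub>R (axis i 1 - axis j 1) \<in> W"
    by (metis W inv subspace_diff x(1))
  then have ij: "axis i 1 - axis j 1 \<in> W"
    using subspace_scale[OF W, of _ "1 / (x $ i - x $ j)"] x(2) by fastforce
  have "i \<noteq> j" using x(2) by auto
  have diff: "axis i 1 - axis l 1 \<in> W" for l
  proof (cases "l = i")
    case True
    then show ?thesis using subspace_0[OF W] by simp
  next
    case False
    have "(\<chi> k. (axis i 1 - axis j 1) $ Transposition.transpose j l k) = axis i 1 - axis l (1::real)"
      using False \<open>i \<noteq> j\<close> by (auto simp: vec_eq_iff axis_def Transposition.transpose_def)
    then show ?thesis using inv[OF ij, of j l] by simp
  qed
  have sum_axis: "(\<Sum>l\<in>UNIV. axis l 1) = (vec 1 :: real ^ 'n)"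
    by (simp add: vec_eq_iff axis_def)
  \<comment> \<open>The subtracted axis vectors add up to \<open>vec 1\<close>, leaving
    \<open>CARD('n)\<close> copies of \<open>axis i 1\<close>.\<close>
  have "vec 1 + (\<Sum>l\<in>UNIV. axis i 1 - axis l 1) \<in> W"
    by (intro subspace_add[OF W] subspace_sum[OF W] one diff)
  then have "real CARD('n) *\<^sub>R axis i 1 \<in> W"
    by (simp add: sum_subtractf sum_axis sum_constant_scaleR del: sum_constant)
  then have axis_i: "axis i 1 \<in> W"
    using subspace_scale[OF W, of _ "1 / real CARD('n)"] by fastforce
  have "axis l 1 \<in> W" for l
  proof -
    have "(\<chi> k. axis i 1 $ Transposition.transpose i l k) = axis l (1::real)"
      by (auto simp: vec_eq_iff axis_def Transposition.transpose_def)
    then show ?thesis using inv[OF axis_i, of i l] by simp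
  qed
  then have "(\<Sum>l\<in>UNIV. y $ l *\<^sub>R axis l 1) \<in> W" for y :: "real ^ 'n"
    by (intro subspace_sum[OF W] subspace_scale[OF W])
  then show ?thesis
    using basis_expansion by (metis (no_types, lifting) UNIV_eq_I scalar_mult_eq_scaleR sum.cong)
qed

text \<open>Translating the interior by \<open>y\<close> gives an open subset of
  \<open>K\<close>.\<close>

lemma interior_add_cone:
  fixes K :: "'a::euclidean_space set"
  assumes "convex_cone K" "x \<in> interior K" "y \<in> K"
  shows "x + y \<in> interior K"
proof -
  have "(+) y ` interior K \<subseteq> K"
    using assms interior_subset convex_cone_add by (metis image_subsetI subsetD)
  moreover have "open ((+) y ` interior K)"
    by (intro open_translation open_interior)
  ultimately have "(+) y ` interior K \<subseteq> interior K"
    by (intro interior_maximal)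
  then show ?thesis
    using assms(2) by (auto simp: add.commute)
qed

lemma constant_interior_point:
  fixes Q :: "(real ^ 'n) set"
  assumes "convex_cone Q" "permutation_invariant Q" "interior Q \<noteq> {}"
  obtains c where "vec c \<in> interior Q"
proof -
  obtain x where x: "x \<in> interior Q" using assms(3) by blast
  define P where "P = {p. p permutes (UNIV :: 'n set)}"
  \<comment> \<open>The sum need not be normalised: the identity contributes the interior point and
    all other terms lie in \<open>Q\<close>.\<close>
  define u where "u = (\<Sum>p\<in>P. \<chi> i. x $ p i)"
  have "finite P" "id \<in> P"
    by (auto simp: P_def finite_permutations permutes_id)
  then have "u = x + (\<Sum>p\<in>P - {id}. \<chi> i. x $ p i)"
    unfolding u_def by (subst sum.remove[of _ id]) auto
  moreover have "(\<Sum>p\<in>P - {id}. \<chi> i. x $ p i) \<in> Q"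
    using x interior_subset assms
    by (intro convex_cone_sum permutation_invariant_coords) (auto simp: P_def)
  ultimately have u: "u \<in> interior Q"
    using interior_add_cone assms(1) x by metis
  have "u $ i = u $ j" for i j
  proof -
    have "u $ i = (\<Sum>p\<in>P. x $ p i)"
      by (simp add: u_def)
    \<comment> \<open>Composition with a transposition only reindexes the sum over all
      permutations.\<close>
    also have "\<dots> = (\<Sum>p\<in>P. x $ (p \<circ> Transposition.transpose i j) i)"
      unfolding P_def by (rule sum_permutations_compose_right) (rule permutes_swap_id, auto)
    also have "\<dots> = u $ j"
      by (simp add: u_def)
    finally show ?thesis .
  qed
  \<comment> \<open>All coordinates agree, so the arbitrary index \<open>undefined\<close>
    serves.\<close>
  then have "u = vec (u $ undefined)"
    by (auto simp: vec_eq_iff)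
  with u that show ?thesis by metis
qed

text \<open>An orthogonal involution is self-adjoint, so \<open>T\<close> preserves the dual cone
  along with \<open>K\<close> and takes orthogonal pairs to orthogonal pairs.\<close>

lemma LL_conj_orthogonal:
  assumes L: "L \<in> LL K" and T: "linear T" "\<And>x. T (T x) = x" "\<And>x y. T x \<bullet> T y = x \<bullet> y"
    and K: "\<And>x. x \<in> K \<Longrightarrow> T x \<in> K"
  obtains M where "M \<in> LL K" "\<And>x. blinfun_apply M x = T (blinfun_apply L (T x))"
proof -
  define M where "M = Blinfun (\<lambda>x. T (blinfun_apply L (T x)))"
  have bl: "bounded_linear T"
    using T(1) by (simp add: linear_conv_bounded_linear)
  have "bounded_linear (\<lambda>x. T (blinfun_apply L (T x)))"
    by (rule bounded_linear_compose[OF bl bounded_linear_compose[OF blinfun.bounded_linear_right bl]])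
  then have M: "blinfun_apply M x = T (blinfun_apply L (T x))" for x
    by (simp add: M_def bounded_linear_Blinfun_apply)
  have adj: "T x \<bullet> y = x \<bullet> T y" for x y
    using T(3)[of x "T y"] T(2) by simp
  have "blinfun_apply M x \<bullet> s = 0" if "x \<in> K" "s \<in> dual_cone K" "x \<bullet> s = 0" for x s
  proof -
    have "T s \<in> dual_cone K"
      using that(2) K by (auto simp: dual_cone_def adj)
    moreover have "T x \<bullet> T s = 0" using that(3) T(3) by simp
    ultimately show ?thesis
      using L K[OF that(1)] by (auto simp: LL_def lyapunov_like_def M adj)
  qed
  then have "M \<in> LL K" by (auto simp: LL_def lyapunov_like_def)
  with M that show ?thesis by blast
qed

text \<open>Supplies the hypothesis \<open>trans\<close> of the rank and independence lemmas, with
  the constant interior vector as \<open>u\<close>.\<close>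

lemma reducible_LL_transitive:
  fixes Q :: "(real ^ 'n) set"
  assumes "reducible_cone Q" and pointed: "pointed_cone Q" and perm: "permutation_invariant Q"
    and c: "vec c \<in> interior Q"
  shows "\<exists>L\<in>LL Q. blinfun_apply L (vec c) = x"
proof -
  define W where "W = (\<lambda>L. blinfun_apply L (vec c)) ` LL Q"
  have "linear (\<lambda>L. blinfun_apply L (vec c :: real ^ 'n) :: real ^ 'n)"
    by (intro bounded_linear.linear blinfun.bounded_linear_left)
  then have subW: "subspace W"
    unfolding W_def by (intro linear_subspace_image subspace_LL)
  have "id_blinfun \<in> LL Q"
    by (auto simp: LL_def lyapunov_like_def)
  then have cW: "vec c \<in> W"
    unfolding W_def by force
  obtain L where L: "L \<in> LL Q" "blinfun_apply L (vec c) \<notin> span {vec c}"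
    using reducible_LL_not_scalar[OF assms(1) pointed c] .
  \<comment> \<open>A ball around 0 inside \<open>Q\<close> would contradict pointedness. Nonzero
    \<open>c\<close> makes every constant vector a multiple of \<open>vec c\<close>.\<close>
  have "c \<noteq> 0"
  proof
    assume "c = 0"
    then have "0 \<in> interior Q" using c by simp
    then obtain e where e: "e > 0" "ball 0 e \<subseteq> Q" by (auto simp: mem_interior)
    let ?y = "(e / 2) *\<^sub>R axis undefined 1 :: real ^ 'n"
    have "?y \<in> Q" "- ?y \<in> Q"
      using e by (auto intro!: subsetD[OF e(2)] simp: norm_axis_1)
    then have "?y = 0" by (rule pointed_coneD[OF pointed])
    with e show False by (simp add: axis_eq_0_iff)
  qed
  then have vec_c: "vec d = (d / c) *\<^sub>R (vec c :: real ^ 'n)" for d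
    by (simp add: vec_eq_iff)
  have "W = UNIV"
  proof -
    have "\<exists>i j. blinfun_apply L (vec c) $ i \<noteq> blinfun_apply L (vec c) $ j"
    proof (rule ccontr)
      assume "\<not> ?thesis"
      then have "blinfun_apply L (vec c) = vec (blinfun_apply L (vec c) $ undefined)"
        by (auto simp: vec_eq_iff)
      with L(2) show False
        by (metis vec_c span_base span_scale singletonI)
    qed
    then obtain i j where ij: "blinfun_apply L (vec c) $ i \<noteq> blinfun_apply L (vec c) $ j"
      by blast
    show ?thesis
    proof (rule transposition_invariant_subspace_UNIV[OF subW _ _ _ ij])
      show "vec 1 \<in> W" using cW subW by (subst vec_c) (rule subspace_scale)
      show "blinfun_apply L (vec c) \<in> W" using L(1) by (auto simp: W_def)
      fix k l :: 'n and x assume "x \<in> W"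
      then obtain A where A: "A \<in> LL Q" "x = blinfun_apply A (vec c)" by (auto simp: W_def)
      let ?p = "Transposition.transpose k l"
      let ?T = "\<lambda>x :: real ^ 'n. \<chi> i. x $ ?p i"
      have p: "?p permutes UNIV" by (rule permutes_swap_id) auto
      obtain B where B: "B \<in> LL Q" "\<And>x. blinfun_apply B x = ?T (blinfun_apply A (?T x))"
      proof (rule LL_conj_orthogonal[OF A(1), of ?T])
        show "linear ?T" by (rule linearI) (auto simp: vec_eq_iff)
        show "?T (?T x) = x" for x by (simp add: vec_eq_iff)
        show "?T x \<bullet> ?T y = x \<bullet> y" for x y
          using sum.permute[OF p, of "\<lambda>i. x $ i \<bullet> y $ i"] by (simp add: inner_vec_def comp_def)
        show "?T x \<in> Q" if "x \<in> Q" for x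
          using permutation_invariant_coords[OF perm p that] .
      qed (use that in blast)
      \<comment> \<open>The transposition fixes \<open>vec c\<close>, so the conjugate of
        \<open>A\<close> by it sends \<open>vec c\<close> to \<open>?T x\<close>.\<close>
      have "?T (vec c) = vec c" by (simp add: vec_eq_iff)
      then have "?T x = blinfun_apply B (vec c)" using A(2) B(2) by metis
      with B(1) show "?T x \<in> W" by (auto simp: W_def)
    qed
  qed
  then show ?thesis by (metis (no_types, lifting) UNIV_I W_def imageE)
qed

theorem theorem4p1:
  fixes Q :: "(real ^ 'n) set"
  assumes "proper_cone Q"
    and "polyhedral_cone Q"
    and "permutation_invariant Q"
  shows "(irreducible_cone Q \<and> lyapunov_rank Q = 1) \<or>
         (reducible_cone Q \<and> isomorphic_cones Q (nonneg_orthant :: (real ^ 'n) set) \<and>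
            lyapunov_rank Q = CARD('n))"
proof -
  have cone: "convex_cone Q" "pointed_cone Q" "solid_cone Q"
    using assms(1) by (auto simp: proper_cone_def)
  obtain S0 where "finite S0" "Q = convex_cone hull S0"
    using assms(2) by (auto simp: polyhedral_cone_def convex_cone_hull_finite)
  then obtain S where S: "finite S" "Q = convex_cone hull S"
    "\<And>v. v \<in> S \<Longrightarrow> v \<notin> convex_cone hull (S - {v})"
    using ex_minimal_cone_generators by metis
  have span_Q: "span Q = UNIV"
    using cone(3) by (rule span_solid_cone)
  have "span S = UNIV"
    using span_minimal[OF convex_cone_hull_subset_span subspace_span, of S] S(2) span_Q by auto
  then interpret minimal_cone_generators Q S
    using S pointed_coneD[OF cone(2)] by unfold_locales auto
  show ?thesis
  proof (cases "reducible_cone Q")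
    case True
    obtain c where "vec c \<in> interior Q"
      using constant_interior_point cone assms(3) unfolding solid_cone_def by metis
    then have trans: "\<exists>L\<in>LL Q. blinfun_apply L (vec c) = x" for x
      using reducible_LL_transitive True cone(2) assms(3) by blast
    have "isomorphic_cones Q (nonneg_orthant :: (real ^ 'n) set)"
      unfolding S(2) by (rule isomorphic_cones_orthant[OF independent_gens_transitive[OF trans] span_S])
    with True lyapunov_rank_transitive[OF trans] show ?thesis by simp
  next
    case False
    moreover have "Q \<noteq> {0}" using cone(3) by (auto simp: solid_cone_def)
    ultimately have "irreducible_cone Q"
      using cone(1) by (simp add: irreducible_cone_def)
    with irreducible_lyapunov_rank show ?thesis by blast
  qed
qed

end
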